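(* Let $F^z$ be the problem of minimizing $\sum_{j\in P}\omega_j\theta_j$ over the set $\Omega^z$ of all $(x,z,\theta)$ with $x\in Q$, $z\in\{0,1\}^{p\times p}$, $\theta\in\mathbb{R}^p$ satisfying (b) $\sum_{i\in P}z_{ij}=1$ for all $j\in P$; (c) $\sum_{j\in P}z_{ij}=1$ for all $i\in P$; (d) $C^i x\le \theta_j+M\bigl(1-\sum_{k\ge j}z_{ik}\bigr)$ for all $i,j\in P$; (e) $\theta_j\ge\theta_{j+1}$ for all $j\in P$, $j<p$. Let $F^z_{R3}$ be the problem of minimizing the same objective over the set $\Omega^z_{R3}$ of all $(x,z,\theta)$ with $x\in Q$, $z\in\{0,1\}^{p\times p}$, $\theta\in\mathbb{R}^p$ satisfying (b$_\le$) $\sum_{i\in P}z_{ij}\le 1$ for all $j\in P$; (d$'$) $C^i x\le \theta_j+M\sum_{k<j}z_{ik}$ for all $i,j\in P$. Then $F^z$ and $F^z_{R3}$ have the same set of optimal solutions.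
   Context: $P=\{1,\dots,p\}$. $Q\subseteq\mathbb{R}^n$ is the feasible set of a combinatorial optimization problem (a combinatorial object representable by a system of linear inequalities). $C\in\mathbb{R}^{p\times n}$ is a matrix whose rows $C^i$, $i\in P$, are the cost vectors of $p$ objective (cost) functions $x\mapsto C^i x$. $\omega=(\omega_j)_{j\in P}$ is a vector of non-negative weights. $M$ is a non-negative upper bound on the value of all the cost functions, i.e. $M\ge 0$ and $C^i x\le M$ for all $x\in Q$, $i\in P$.
   Formalization: Optimal solutions are compared in x; on triples (x,z,θ), where equality fails, only inclusion of those of F^z in those of F^z_R3 is stated. Also assumed: C^i x − C^k x ≤ M for x∈Q, i,k∈P (automatic for non-negative costs; the claim can fail without it). *)

theory Defs
  imports "HOL-Analysis.Analysis"
begin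

text \<open>
  Cost vectors \<open>C i\<close>, positions and \<open>z\<close>, \<open>\<theta>\<close> are indexed by \<open>{1..p}\<close>; extensional function
  spaces make \<open>z\<close> and \<open>\<theta>\<close> genuine elements of \<open>{0,1}\<close>-matrices of size \<open>p \<times> p\<close> and of
  \<open>p\<close>-dimensional real space, without junk outside the index range.
\<close>

type_synonym 'n point = "(real ^ 'n) \<times> (nat \<Rightarrow> nat \<Rightarrow> real) \<times> (nat \<Rightarrow> real)"

definition binary_matrices :: "nat \<Rightarrow> (nat \<Rightarrow> nat \<Rightarrow> real) set" where
  "binary_matrices p = {1..p} \<rightarrow>\<^sub>E ({1..p} \<rightarrow>\<^sub>E {0, 1})"

definition Omega_z ::
  "nat \<Rightarrow> (real ^ 'n) set \<Rightarrow> (nat \<Rightarrow> real ^ 'n) \<Rightarrow> real \<Rightarrow> 'n point set" where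
  "Omega_z p Q C M = {(x, z, \<theta>).
     x \<in> Q \<and> z \<in> binary_matrices p \<and> \<theta> \<in> {1..p} \<rightarrow>\<^sub>E UNIV \<and>
     (\<forall>j\<in>{1..p}. (\<Sum>i\<in>{1..p}. z i j) = 1) \<and>
     (\<forall>i\<in>{1..p}. (\<Sum>j\<in>{1..p}. z i j) = 1) \<and>
     (\<forall>i\<in>{1..p}. \<forall>j\<in>{1..p}. C i \<bullet> x \<le> \<theta> j + M * (1 - (\<Sum>k\<in>{j..p}. z i k))) \<and>
     (\<forall>j\<in>{1..p}. j < p \<longrightarrow> \<theta> j \<ge> \<theta> (j + 1))}"

definition Omega_z_R3 ::
  "nat \<Rightarrow> (real ^ 'n) set \<Rightarrow> (nat \<Rightarrow> real ^ 'n) \<Rightarrow> real \<Rightarrow> 'n point set" where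
  "Omega_z_R3 p Q C M = {(x, z, \<theta>).
     x \<in> Q \<and> z \<in> binary_matrices p \<and> \<theta> \<in> {1..p} \<rightarrow>\<^sub>E UNIV \<and>
     (\<forall>j\<in>{1..p}. (\<Sum>i\<in>{1..p}. z i j) \<le> 1) \<and>
     (\<forall>i\<in>{1..p}. \<forall>j\<in>{1..p}. C i \<bullet> x \<le> \<theta> j + M * (\<Sum>k\<in>{1..<j}. z i k))}"

definition owa_objective :: "nat \<Rightarrow> (nat \<Rightarrow> real) \<Rightarrow> 'n point \<Rightarrow> real" where
  "owa_objective p \<omega> = (\<lambda>(x, z, \<theta>). \<Sum>j\<in>{1..p}. \<omega> j * \<theta> j)"

definition optimal_solutions :: "('s \<Rightarrow> real) \<Rightarrow> 's set \<Rightarrow> 's set" where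
  "optimal_solutions f S = {s. is_arg_min f (\<lambda>t. t \<in> S) s}"

text \<open>
  The two problems can only share their optimal solutions in the original variables \<open>x\<close>:
  the last column of \<open>z\<close> is not used by \<^const>\<open>Omega_z_R3\<close> and may be zero there, whereas
  \<^const>\<open>Omega_z\<close> forces it to sum to one; and if some weight vanishes, the corresponding
  entry of \<open>\<theta>\<close> need not be in order for \<^const>\<open>Omega_z_R3\<close>. On full triples only the inclusion
  of the optimal solutions over \<^const>\<open>Omega_z\<close> in those over \<^const>\<open>Omega_z_R3\<close> survives.

  Moreover \<open>C i \<bullet> x \<le> M\<close> alone does not make \<open>M\<close> a valid big-M constant when costs may be
  negative: inactive constraints then cut off sorted cost vectors, and, since row sums of
  \<open>z\<close> may exceed one in \<^const>\<open>Omega_z_R3\<close>, they do so differently in the two problems. The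
  condition needed is \<open>C i \<bullet> x - C k \<bullet> x \<le> M\<close>, which for non-negative costs follows from the upper bound:
\<close>

lemma big_M_valid_if_nonneg_costs:
  fixes Q :: "(real ^ 'n) set" and C :: "nat \<Rightarrow> real ^ 'n"
  assumes "\<And>x i. x \<in> Q \<Longrightarrow> i \<in> {1..p} \<Longrightarrow> 0 \<le> C i \<bullet> x"
    and "\<And>x i. x \<in> Q \<Longrightarrow> i \<in> {1..p} \<Longrightarrow> C i \<bullet> x \<le> M"
    and "x \<in> Q" "i \<in> {1..p}" "k \<in> {1..p}"
  shows "C i \<bullet> x - C k \<bullet> x \<le> M"
  using assms(1)[OF assms(3,5)] assms(2)[OF assms(3,4)] by linarith

end

theory Submission
  imports Defs
begin

text \<open>
  For fixed \<open>x\<close>, sort the costs decreasingly. The columns before \<open>j\<close> of a feasible \<open>z\<close> of the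
  relaxation contain at most \<open>j - 1\<close> ones, so they miss one of the rows of the \<open>j\<close> largest costs,
  and the big-M constraint of that row forces \<open>\<theta> j\<close> to be at least the \<open>j\<close>-th largest cost. The
  sorted costs with their sorting permutation are feasible for the original problem, which is a
  restriction of the relaxation. Hence restricting to it loses nothing at any \<open>x\<close>.
\<close>

text \<open>A minimizer over \<open>T\<close> beats every \<open>s\<close> in \<open>S\<close>
  through the element of \<open>T\<close> that dominates \<open>s\<close>. Conversely, the element
  dominating a minimizer over \<open>S\<close> is itself a minimizer with the same \<open>h\<close>.
  It may differ from that minimizer, so only the images under \<open>h\<close> agree.\<close>

lemma optimal_solutions_restrict:
  fixes f :: "'s \<Rightarrow> real"
  assumes "T \<subseteq> S"
    and dominated: "\<And>s. s \<in> S \<Longrightarrow> \<exists>t\<in>T. h t = h s \<and> f t \<le> f s"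
  shows "h ` optimal_solutions f T = h ` optimal_solutions f S"
    and "optimal_solutions f T \<subseteq> optimal_solutions f S"
proof -
  show sub: "optimal_solutions f T \<subseteq> optimal_solutions f S"
  proof
    fix t assume "t \<in> optimal_solutions f T"
    then have t: "t \<in> T" "\<And>u. u \<in> T \<Longrightarrow> f t \<le> f u"
      by (auto simp: optimal_solutions_def is_arg_min_linorder)
    have "f t \<le> f s" if "s \<in> S" for s
      using dominated[OF that] t(2) by (meson order_trans)
    then show "t \<in> optimal_solutions f S"
      using t(1) \<open>T \<subseteq> S\<close> by (auto simp: optimal_solutions_def is_arg_min_linorder)
  qed
  have "h s \<in> h ` optimal_solutions f T" if "s \<in> optimal_solutions f S" for s
  proof -
    have s: "s \<in> S" "\<And>u. u \<in> S \<Longrightarrow> f s \<le> f u"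
      using that by (auto simp: optimal_solutions_def is_arg_min_linorder)
    obtain t where t: "t \<in> T" "h t = h s" "f t \<le> f s"
      using dominated[OF s(1)] by blast
    have "f t \<le> f u" if "u \<in> T" for u
      using t(3) s(2)[of u] that \<open>T \<subseteq> S\<close> by fastforce
    then have "t \<in> optimal_solutions f T"
      using t(1) by (auto simp: optimal_solutions_def is_arg_min_linorder)
    then show ?thesis
      using t(2) by (metis imageI)
  qed
  with sub show "h ` optimal_solutions f T = h ` optimal_solutions f S"
    by blast
qed

lemma ex_decreasing_enumeration:
  fixes c :: "nat \<Rightarrow> 'a::linorder"
  shows "\<exists>\<pi>. bij_betw \<pi> {1..p} {1..p} \<and>
    (\<forall>k\<in>{1..p}. \<forall>l\<in>{1..p}. k \<le> l \<longrightarrow> c (\<pi> l) \<le> c (\<pi> k))"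
proof -
  \<comment> \<open>\<open>sort_key\<close> sorts increasingly, hence the reversal.\<close>
  define xs where "xs = rev (sort_key c [1..<Suc p])"
  have xs: "length xs = p" "set xs = {1..p}" "distinct xs"
    by (auto simp: xs_def)
  have "sorted (rev (map c xs))"
    by (simp add: xs_def rev_map)
  then have mono: "c (xs ! l) \<le> c (xs ! k)" if "k \<le> l" "l < p" for k l
    using sorted_rev_nth_mono[of "map c xs" k l] that xs(1) by simp
  have "bij_betw ((!) xs) {..<p} {1..p}"
    using bij_betw_nth[OF xs(3)] xs by auto
  \<comment> \<open>List positions start at 0, ranks at 1.\<close>
  moreover have "bij_betw (\<lambda>j. j - 1) {1..p} {..<p}"
    by (rule bij_betw_byWitness[where f' = Suc]) auto
  ultimately have "bij_betw (\<lambda>j. xs ! (j - 1)) {1..p} {1..p}"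
    using bij_betw_trans by (fastforce simp: comp_def)
  then show ?thesis
    using mono by (intro exI[of _ "\<lambda>j. xs ! (j - 1)"]) auto
qed

lemma binary_matrices_entry:
  assumes "z \<in> binary_matrices p" "i \<in> {1..p}" "j \<in> {1..p}"
  shows "z i j \<in> {0, 1}"
  using assms unfolding binary_matrices_def by (blast dest: PiE_mem)

text \<open>Pigeonhole: the \<open>j - 1\<close> columns before \<open>j\<close> hold at most one 1
  each, too few to meet all \<open>j\<close> rows of \<open>I\<close>.\<close>

lemma ex_row_missed_by_first_columns:
  assumes z: "z \<in> binary_matrices p"
    and cols: "\<And>j. j \<in> {1..p} \<Longrightarrow> (\<Sum>i\<in>{1..p}. z i j) \<le> 1"
    and I: "I \<subseteq> {1..p}" "card I = j" and j: "j \<in> {1..p}"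
  shows "\<exists>i\<in>I. (\<Sum>k\<in>{1..<j}. z i k) = 0"
proof (rule ccontr)
  assume contra: "\<not> ?thesis"
  have entry: "z i k \<in> {0, 1}" if "i \<in> {1..p}" "k \<in> {1..<j}" for i k
    using binary_matrices_entry[OF z that(1), of k] that(2) j by auto
  have row: "1 \<le> (\<Sum>k\<in>{1..<j}. z i k)" if i: "i \<in> I" for i
  proof -
    have "(\<Sum>k\<in>{1..<j}. z i k) \<noteq> 0"
      using contra i by blast
    then obtain k where k: "k \<in> {1..<j}" "z i k \<noteq> 0"
      by (meson sum.neutral)
    have i': "i \<in> {1..p}"
      using i I(1) by blast
    have nonneg: "0 \<le> z i k'" if "k' \<in> {1..<j}" for k'
      using entry[OF i' that] by auto
    have "z i k = 1"
      using entry[OF i' k(1)] k(2) by auto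
    then show ?thesis
      using member_le_sum[of k "{1..<j}" "z i"] k(1) nonneg by auto
  qed
  \<comment> \<open>Count the ones in the block of rows \<open>I\<close> and columns before
    \<open>j\<close> twice: at least \<open>j\<close> by rows, at most \<open>j - 1\<close> by
    columns.\<close>
  have "real j = (\<Sum>i\<in>I. 1)"
    using I(2) by simp
  also have "\<dots> \<le> (\<Sum>i\<in>I. \<Sum>k\<in>{1..<j}. z i k)"
    using row by (rule sum_mono)
  also have "\<dots> = (\<Sum>k\<in>{1..<j}. \<Sum>i\<in>I. z i k)"
    by (rule sum.swap)
  also have "\<dots> \<le> (\<Sum>k\<in>{1..<j}. 1)"
  proof (rule sum_mono)
    fix k assume k: "k \<in> {1..<j}"
    have nonneg: "0 \<le> z i k" if "i \<in> {1..p}" for i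
      using entry[OF that k] by auto
    have "(\<Sum>i\<in>I. z i k) \<le> (\<Sum>i\<in>{1..p}. z i k)"
      using I(1) nonneg by (intro sum_mono2) auto
    also have "\<dots> \<le> 1"
      using cols[of k] k j by auto
    finally show "(\<Sum>i\<in>I. z i k) \<le> 1" .
  qed
  also have "\<dots> < real j"
    using j by simp
  finally show False
    by simp
qed

text \<open>Since each row sums to one, the complement of its tail from \<open>j\<close> is its head
  before \<open>j\<close>, so the two big-M constraints coincide on \<open>Omega_z\<close>.\<close>

lemma Omega_z_subset_Omega_z_R3: "Omega_z p Q C M \<subseteq> Omega_z_R3 p Q C M"
proof
  fix s assume s: "s \<in> Omega_z p Q C M"
  obtain x z \<theta> where [simp]: "s = (x, z, \<theta>)"
    by (metis prod.exhaust)
  have "C i \<bullet> x \<le> \<theta> j + M * (\<Sum>k\<in>{1..<j}. z i k)" if ij: "i \<in> {1..p}" "j \<in> {1..p}" for i j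
  proof -
    have "{1..p} = {1..<j} \<union> {j..p}"
      using ij(2) by auto
    then have "(\<Sum>k\<in>{1..p}. z i k) = (\<Sum>k\<in>{1..<j}. z i k) + (\<Sum>k\<in>{j..p}. z i k)"
      by (simp only:) (rule sum.union_disjoint, auto)
    moreover have "(\<Sum>k\<in>{1..p}. z i k) = 1"
      and "C i \<bullet> x \<le> \<theta> j + M * (1 - (\<Sum>k\<in>{j..p}. z i k))"
      using s ij by (auto simp: Omega_z_def)
    ultimately show ?thesis
      by (metis add_diff_cancel_right')
  qed
  then show "s \<in> Omega_z_R3 p Q C M"
    using s by (auto simp: Omega_z_def Omega_z_R3_def)
qed

text \<open>The matrix is the permutation matrix of the sorting: its one in column \<open>j\<close>
  marks the cost of rank \<open>j\<close>.\<close>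

lemma sorted_point_in_Omega_z:
  fixes C :: "nat \<Rightarrow> real ^ 'n"
  assumes x: "x \<in> Q"
    and valid: "\<And>i k. i \<in> {1..p} \<Longrightarrow> k \<in> {1..p} \<Longrightarrow> C i \<bullet> x - C k \<bullet> x \<le> M"
    and bij: "bij_betw \<pi> {1..p} {1..p}"
    and decr: "\<And>k l. k \<in> {1..p} \<Longrightarrow> l \<in> {1..p} \<Longrightarrow> k \<le> l \<Longrightarrow> C (\<pi> l) \<bullet> x \<le> C (\<pi> k) \<bullet> x"
  shows "(x, (\<lambda>i\<in>{1..p}. \<lambda>j\<in>{1..p}. of_bool (i = \<pi> j)), (\<lambda>j\<in>{1..p}. C (\<pi> j) \<bullet> x))
    \<in> Omega_z p Q C M"
proof -
  define z :: "nat \<Rightarrow> nat \<Rightarrow> real"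
    where "z = (\<lambda>i\<in>{1..p}. \<lambda>j\<in>{1..p}. of_bool (i = \<pi> j))"
  have z: "z i j = of_bool (i = \<pi> j)" if "i \<in> {1..p}" "j \<in> {1..p}" for i j
    using that by (simp add: z_def)
  have \<pi>: "\<pi> j \<in> {1..p}" if "j \<in> {1..p}" for j
    using bij that by (rule bij_betwE[rule_format])
  have bin: "z \<in> binary_matrices p"
    unfolding z_def binary_matrices_def by (auto simp: PiE_iff)
  have cols: "(\<Sum>i\<in>{1..p}. z i j) = 1" if "j \<in> {1..p}" for j
  proof -
    have "(\<Sum>i\<in>{1..p}. z i j) = (\<Sum>i\<in>{1..p}. if i = \<pi> j then 1 else 0)"
      using that by (intro sum.cong) (auto simp: z)
    also have "\<dots> = 1"
      using \<pi>[OF that] by (subst sum.delta) auto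
    finally show ?thesis .
  qed
  \<comment> \<open>By injectivity of \<open>\<pi>\<close>, row \<open>\<pi> l\<close> has its only
    one in column \<open>l\<close>. The case \<open>j = 1\<close> gives the full row sum.\<close>
  have rows: "(\<Sum>k\<in>{j..p}. z i k) = of_bool (j \<le> l)"
    if "i = \<pi> l" "l \<in> {1..p}" "j \<in> {1..p}" for i j l
  proof -
    have "(\<Sum>k\<in>{j..p}. z i k) = (\<Sum>k\<in>{j..p}. if k = l then 1 else 0)"
      using that \<pi>[OF that(2)] bij_betw_imp_inj_on[OF bij]
      by (intro sum.cong) (auto simp: z dest: inj_onD)
    also have "\<dots> = of_bool (j \<le> l)"
      using that by (subst sum.delta) auto
    finally show ?thesis .
  qed
  have ex_position: "\<exists>l\<in>{1..p}. i = \<pi> l" if "i \<in> {1..p}" for i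
    using bij_betw_imp_surj_on[OF bij] that by blast
  have "(\<Sum>k\<in>{1..p}. z i k) = 1" if i: "i \<in> {1..p}" for i
  proof -
    obtain l where "l \<in> {1..p}" "i = \<pi> l"
      using ex_position[OF i] by blast
    then show ?thesis
      using rows[of i l 1] by auto
  qed
  moreover have "C i \<bullet> x \<le> C (\<pi> j) \<bullet> x + M * (1 - (\<Sum>k\<in>{j..p}. z i k))"
    if i: "i \<in> {1..p}" and j: "j \<in> {1..p}" for i j
  proof -
    obtain l where l: "l \<in> {1..p}" "i = \<pi> l"
      using ex_position[OF i] by blast
    \<comment> \<open>If \<open>j \<le> l\<close>, the big-M term vanishes and the sorting gives the
      bound. Otherwise the full slack \<open>M\<close> is available and covers the difference of the
      two costs by \<open>valid\<close>.\<close>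
    show ?thesis
      using rows[OF l(2,1) j] decr[OF j l(1)] l(2) valid[OF i \<pi>[OF j]]
      by (cases "j \<le> l") auto
  qed
  ultimately show ?thesis
    unfolding z_def[symmetric] Omega_z_def
    using x bin cols decr by auto
qed

text \<open>Among the rows of the \<open>j\<close> largest costs, one has its big-M term at
  \<open>j\<close> equal to zero. Its cost is at least the \<open>j\<close>-th largest, whichever of
  these rows it is.\<close>

lemma sorted_costs_le_theta:
  assumes s: "(x, z, \<theta>) \<in> Omega_z_R3 p Q C M"
    and bij: "bij_betw \<pi> {1..p} {1..p}"
    and decr: "\<And>k l. k \<in> {1..p} \<Longrightarrow> l \<in> {1..p} \<Longrightarrow> k \<le> l \<Longrightarrow> C (\<pi> l) \<bullet> x \<le> C (\<pi> k) \<bullet> x"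
    and j: "j \<in> {1..p}"
  shows "C (\<pi> j) \<bullet> x \<le> \<theta> j"
proof -
  have "inj_on \<pi> {1..j}" and sub: "\<pi> ` {1..j} \<subseteq> {1..p}"
    using bij j by (auto simp: bij_betw_def intro: inj_on_subset)
  then have "card (\<pi> ` {1..j}) = j"
    by (simp add: card_image)
  moreover have "z \<in> binary_matrices p" "\<And>j. j \<in> {1..p} \<Longrightarrow> (\<Sum>i\<in>{1..p}. z i j) \<le> 1"
    using s by (auto simp: Omega_z_R3_def)
  ultimately obtain l where l: "l \<in> {1..j}" "(\<Sum>k\<in>{1..<j}. z (\<pi> l) k) = 0"
    using ex_row_missed_by_first_columns[of z p "\<pi> ` {1..j}" j] sub j by blast
  have "C (\<pi> j) \<bullet> x \<le> C (\<pi> l) \<bullet> x"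
    using decr[of l j] l(1) j by auto
  also have "\<dots> \<le> \<theta> j + M * (\<Sum>k\<in>{1..<j}. z (\<pi> l) k)"
  proof -
    have "\<pi> l \<in> {1..p}"
      using sub l(1) by blast
    then show ?thesis
      using s j by (auto simp: Omega_z_R3_def)
  qed
  finally show ?thesis
    using l(2) by simp
qed

theorem mainTheorem4:
  fixes p :: nat
    and Q :: "(real ^ 'n) set"
    and C :: "nat \<Rightarrow> real ^ 'n"
    and \<omega> :: "nat \<Rightarrow> real"
    and M :: real
  assumes weights_nonneg: "\<And>j. j \<in> {1..p} \<Longrightarrow> 0 \<le> \<omega> j"
    and M_nonneg: "0 \<le> M"
    and M_upper: "\<And>x i. x \<in> Q \<Longrightarrow> i \<in> {1..p} \<Longrightarrow> C i \<bullet> x \<le> M"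
    and M_valid: "\<And>x i k. x \<in> Q \<Longrightarrow> i \<in> {1..p} \<Longrightarrow> k \<in> {1..p} \<Longrightarrow> C i \<bullet> x - C k \<bullet> x \<le> M"
  shows "fst ` optimal_solutions (owa_objective p \<omega>) (Omega_z p Q C M) =
           fst ` optimal_solutions (owa_objective p \<omega>) (Omega_z_R3 p Q C M) \<and>
         optimal_solutions (owa_objective p \<omega>) (Omega_z p Q C M) \<subseteq>
           optimal_solutions (owa_objective p \<omega>) (Omega_z_R3 p Q C M)"
proof -
  have dominated: "\<exists>t\<in>Omega_z p Q C M. fst t = fst s \<and> owa_objective p \<omega> t \<le> owa_objective p \<omega> s"
    if s: "s \<in> Omega_z_R3 p Q C M" for s
  proof -
    obtain x z \<theta> where s_eq: "s = (x, z, \<theta>)"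
      by (metis prod.exhaust)
    have x: "x \<in> Q"
      using s by (simp add: s_eq Omega_z_R3_def)
    obtain \<pi> where bij: "bij_betw \<pi> {1..p} {1..p}"
      and decr: "\<And>k l. k \<in> {1..p} \<Longrightarrow> l \<in> {1..p} \<Longrightarrow> k \<le> l \<Longrightarrow> C (\<pi> l) \<bullet> x \<le> C (\<pi> k) \<bullet> x"
      using ex_decreasing_enumeration[of p "\<lambda>i. C i \<bullet> x"] by blast
    \<comment> \<open>Non-negative weights carry the entrywise bound over to the objective.\<close>
    have "(\<Sum>j\<in>{1..p}. \<omega> j * (C (\<pi> j) \<bullet> x)) \<le> (\<Sum>j\<in>{1..p}. \<omega> j * \<theta> j)"
      using sorted_costs_le_theta[OF s[unfolded s_eq] bij decr] weights_nonneg
      by (intro sum_mono mult_left_mono) auto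
    \<comment> \<open>The dominating point keeps \<open>x\<close> and replaces \<open>z\<close> and
      \<open>\<theta>\<close> by the sorting permutation and the sorted costs.\<close>
    then show ?thesis
      using sorted_point_in_Omega_z[where C = C, OF x M_valid[OF x] bij decr]
      by (intro bexI) (auto simp: s_eq owa_objective_def)
  qed
  show ?thesis
    using optimal_solutions_restrict[where h = fst, OF Omega_z_subset_Omega_z_R3 dominated] by blast
qed

end
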